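(* Let $k\ge 4$ be an even integer, let $\eta>0$, and let $\beta_1\in[0,1)$, $\beta_2\in(0,1)$. Consider the three-dimensional discrete dynamical system $$\omega_{t+1}=\frac{\beta_1\omega_t}{(1-\eta\omega_t\lambda_t)^{k-1}}+1-\beta_1,\qquad \lambda_{t+1}=\frac{(1-\eta\omega_t\lambda_t)^{k-2}\lambda_t}{\sqrt{\beta_2+(1-\beta_2)(1-\eta\omega_t\lambda_t)^{2k-2}\lambda_t^2x_t^2}},\qquad x_{t+1}=(1-\eta\omega_t\lambda_t)x_t ,$$ with $\lambda_t\ge 0$, and its non-trivial fixed point $(\omega^*,\lambda^*,x^* )$ given by $$\omega^*=\frac{1-\beta_1}{1-\beta_1\beta_2^{-\frac{k-1}{2(k-2)}}},\qquad \lambda^*=\frac{1-\beta_2^{\frac{1}{2(k-2)}}}{\eta\,\omega^*},\qquad x^*=0 .$$ Let $J$ be the $2\times 2$ matrix defined in the context (the $(\omega,\lambda)$-block of the Jacobian at this fixed point) and let $r(J)$ be its spectral radius. Then: (i) (Existence) The non-trivial fixed point exists (i.e. the formulas are well defined and $\lambda^*\ge 0$) if and only if $\beta_1<\beta_2^{\frac{k-1}{2(k-2)}}$. (ii) (Stability) The non-trivial fixed point is asymptotically stable, in the sense that $r(J)<1$, if and only if both $$\beta_1<\beta_2^{\frac{k}{2(k-2)}}\qquad\text{and}\qquad \beta_1>\frac{(k-2)\beta_2^{-\frac{1}{2(k-2)}}-k}{\left(k-(k-2)\beta_2^{\frac{1}{2(k-2)}}\right)\beta_2^{-\frac{k}{2(k-2)}}}.$$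 (iii) (Convergence rate) Within the basin of attraction of the non-trivial fixed point, the iterates converge linearly: for every trajectory $(\omega_t,\lambda_t,x_t)$ with $x_0\neq 0$ that converges to $(\omega^*,\lambda^*,x^* )$, $$\lim_{t\to\infty}\frac{x_{t+1}}{x_t}=\beta_2^{\frac{1}{2(k-2)}} .$$
   Context: The system describes the Adam optimizer (with $\varepsilon=0$ and no bias correction) applied to $L(x)=\frac1k x^k$: $m_t=\beta_1m_{t-1}+(1-\beta_1)x_t^{k-1}$, $v_t=\beta_2v_{t-1}+(1-\beta_2)x_t^{2k-2}$, $x_{t+1}=x_t-\eta m_t/\sqrt{v_t}$, in the variables $\omega_t=m_t/x_t^{k-1}$ and $\lambda_t=x_t^{k-2}/\sqrt{v_t}\ge 0$. Trajectories are understood to be well defined (i.e. $1-\eta\omega_t\lambda_t\ne0$ for all $t$). The basin of attraction of a fixed point is the set of initial states whose trajectory converges to it. With $\Gamma=1-\beta_2^{\frac{1}{2(k-2)}}$, the matrix $J$ has entries $$J_{11}=\beta_1\Gamma(k-1)\beta_2^{\frac{-k}{2(k-2)}}+\beta_1\beta_2^{\frac{1-k}{2(k-2)}},\qquad J_{12}=\frac{\beta_1\eta(1-\beta_1)^2(k-1)\beta_2^{\frac{-k}{2(k-2)}}}{\left(1-\beta_1\beta_2^{-\frac{k-1}{2(k-2)}}\right)^2},$$ $$J_{21}=\frac{\Gamma^2(2-k)\left(1-\beta_1\beta_2^{-\frac{k-1}{2(k-2)}}\right)^2\beta_2^{\frac{k-3}{2(k-2)}}}{\sqrt{\beta_2}\,\eta(1-\beta_1)^2},\qquad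 J_{22}=\frac{\Gamma(2-k)\beta_2^{\frac{k-3}{2(k-2)}}+\sqrt{\beta_2}}{\sqrt{\beta_2}} .$$ The full Jacobian of the system at the fixed point is block diagonal with blocks $J$ and $\beta_2^{\frac{1}{2(k-2)}}$. *)

theory Defs
  imports "HOL-Analysis.Analysis" "Jordan_Normal_Form.Spectral_Radius"
begin

text \<open>
  Adam with zero epsilon and no bias correction, applied to the loss x^k / k, in the coordinates
  \<open>\<omega> = m / x^(k-1)\<close> and \<open>l = x^(k-2) / sqrt v\<close>.  A state is a triple \<open>(\<omega>, l, x)\<close>; since
  \<open>\<lambda>\<close> is reserved syntax, the second coordinate is called \<open>l\<close> throughout.
\<close>

definition adam_step ::
  "nat \<Rightarrow> real \<Rightarrow> real \<Rightarrow> real \<Rightarrow> real \<times> real \<times> real \<Rightarrow> real \<times> real \<times> real" where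
  "adam_step k \<eta> \<beta>\<^sub>1 \<beta>\<^sub>2 = (\<lambda>(\<omega>, l, x).
     (\<beta>\<^sub>1 * \<omega> / (1 - \<eta> * \<omega> * l) ^ (k - 1) + 1 - \<beta>\<^sub>1,
      (1 - \<eta> * \<omega> * l) ^ (k - 2) * l
        / sqrt (\<beta>\<^sub>2 + (1 - \<beta>\<^sub>2) * (1 - \<eta> * \<omega> * l) ^ (2 * k - 2) * l\<^sup>2 * x\<^sup>2),
      (1 - \<eta> * \<omega> * l) * x))"

text \<open>
  The condition \<open>1 - \<eta> * \<omega> * l \<noteq> 0\<close> excludes orbits on which a step would divide by zero (which
  HOL would otherwise totalise).
\<close>

definition adam_trajectory ::
  "nat \<Rightarrow> real \<Rightarrow> real \<Rightarrow> real \<Rightarrow> (nat \<Rightarrow> real) \<Rightarrow> (nat \<Rightarrow> real) \<Rightarrow> (nat \<Rightarrow> real) \<Rightarrow> bool" where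
  "adam_trajectory k \<eta> \<beta>\<^sub>1 \<beta>\<^sub>2 \<omega> l x \<longleftrightarrow>
     (\<forall>t. l t \<ge> 0 \<and> 1 - \<eta> * \<omega> t * l t \<noteq> 0 \<and>
          (\<omega> (Suc t), l (Suc t), x (Suc t)) = adam_step k \<eta> \<beta>\<^sub>1 \<beta>\<^sub>2 (\<omega> t, l t, x t))"

definition omega_denom :: "nat \<Rightarrow> real \<Rightarrow> real \<Rightarrow> real" where
  "omega_denom k \<beta>\<^sub>1 \<beta>\<^sub>2 = 1 - \<beta>\<^sub>1 * \<beta>\<^sub>2 powr (- ((real k - 1) / (2 * (real k - 2))))"

definition omega_star :: "nat \<Rightarrow> real \<Rightarrow> real \<Rightarrow> real" where
  "omega_star k \<beta>\<^sub>1 \<beta>\<^sub>2 = (1 - \<beta>\<^sub>1) / omega_denom k \<beta>\<^sub>1 \<beta>\<^sub>2"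

definition lambda_star :: "nat \<Rightarrow> real \<Rightarrow> real \<Rightarrow> real \<Rightarrow> real" where
  "lambda_star k \<eta> \<beta>\<^sub>1 \<beta>\<^sub>2 =
     (1 - \<beta>\<^sub>2 powr (1 / (2 * (real k - 2)))) / (\<eta> * omega_star k \<beta>\<^sub>1 \<beta>\<^sub>2)"

definition nontrivial_fixed_point :: "nat \<Rightarrow> real \<Rightarrow> real \<Rightarrow> real \<Rightarrow> real \<times> real \<times> real" where
  "nontrivial_fixed_point k \<eta> \<beta>\<^sub>1 \<beta>\<^sub>2 = (omega_star k \<beta>\<^sub>1 \<beta>\<^sub>2, lambda_star k \<eta> \<beta>\<^sub>1 \<beta>\<^sub>2, 0)"

text \<open>
  Existence: both denominators are nonzero, so that neither formula relies on \<open>a / 0 = 0\<close>, and the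
  point lies in the state space \<open>l \<ge> 0\<close>.
\<close>

definition nontrivial_fixed_point_exists :: "nat \<Rightarrow> real \<Rightarrow> real \<Rightarrow> real \<Rightarrow> bool" where
  "nontrivial_fixed_point_exists k \<eta> \<beta>\<^sub>1 \<beta>\<^sub>2 \<longleftrightarrow>
     omega_denom k \<beta>\<^sub>1 \<beta>\<^sub>2 \<noteq> 0 \<and> \<eta> * omega_star k \<beta>\<^sub>1 \<beta>\<^sub>2 \<noteq> 0 \<and> lambda_star k \<eta> \<beta>\<^sub>1 \<beta>\<^sub>2 \<ge> 0"

text \<open>The \<open>(\<omega>, l)\<close>-block of the Jacobian of \<open>adam_step\<close> at the non-trivial fixed point.\<close>

definition adam_J :: "nat \<Rightarrow> real \<Rightarrow> real \<Rightarrow> real \<Rightarrow> real mat" where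
  "adam_J k \<eta> \<beta>\<^sub>1 \<beta>\<^sub>2 =
    (let K = real k;
         d = 2 * (K - 2);
         \<Gamma> = 1 - \<beta>\<^sub>2 powr (1 / d);
         D = 1 - \<beta>\<^sub>1 * \<beta>\<^sub>2 powr (- ((K - 1) / d));
         J\<^sub>1\<^sub>1 = \<beta>\<^sub>1 * \<Gamma> * (K - 1) * \<beta>\<^sub>2 powr (- K / d) + \<beta>\<^sub>1 * \<beta>\<^sub>2 powr ((1 - K) / d);
         J\<^sub>1\<^sub>2 = \<beta>\<^sub>1 * \<eta> * (1 - \<beta>\<^sub>1)\<^sup>2 * (K - 1) * \<beta>\<^sub>2 powr (- K / d) / D\<^sup>2;
         J\<^sub>2\<^sub>1 = \<Gamma>\<^sup>2 * (2 - K) * D\<^sup>2 * \<beta>\<^sub>2 powr ((K - 3) / d) / (sqrt \<beta>\<^sub>2 * \<eta> * (1 - \<beta>\<^sub>1)\<^sup>2);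
         J\<^sub>2\<^sub>2 = (\<Gamma> * (2 - K) * \<beta>\<^sub>2 powr ((K - 3) / d) + sqrt \<beta>\<^sub>2) / sqrt \<beta>\<^sub>2
     in mat_of_rows_list 2 [[J\<^sub>1\<^sub>1, J\<^sub>1\<^sub>2], [J\<^sub>2\<^sub>1, J\<^sub>2\<^sub>2]])"

end

theory Submission
  imports Defs
begin

text \<open>
  Put \<open>q = \<beta>\<^sub>2 powr (1 / (2 * (k - 2)))\<close> and \<open>b = \<beta>\<^sub>1 / q ^ k\<close>.  The fixed point satisfies
  \<open>1 - \<eta> * \<omega> * l = q\<close>, which is also the limit of the ratios of consecutive \<open>x\<close>.  The
  determinant of \<open>J\<close> collapses to \<open>b\<close> and its trace is affine in \<open>b\<close>, so the Schur--Cohn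
  conditions \<open>\<bar>det J\<bar> < 1\<close> and \<open>\<bar>tr J\<bar> < 1 + det J\<close> become exactly the two stability bounds:
  \<open>1 - tr J + det J\<close> equals \<open>(k - 2) * (1 - q) * (1 / q - b)\<close>, which is positive once \<open>b < 1\<close>.
\<close>

section \<open>Schur--Cohn criterion for real quadratics and real two-by-two matrices\<close>

lemma quadratic_roots_in_unit_disc_iff:
  fixes p d :: real
  shows "(\<forall>z::complex. z\<^sup>2 - of_real p * z + of_real d = 0 \<longrightarrow> cmod z < 1) \<longleftrightarrow>
         \<bar>d\<bar> < 1 \<and> \<bar>p\<bar> < 1 + d"
proof
  assume roots: "\<forall>z::complex. z\<^sup>2 - of_real p * z + of_real d = 0 \<longrightarrow> cmod z < 1"
  define s where "s = csqrt (of_real (p\<^sup>2 - 4 * d))"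
  define z1 z2 where "z1 = (of_real p + s) / 2" and "z2 = (of_real p - s) / 2"
  have s2: "s\<^sup>2 = of_real (p\<^sup>2 - 4 * d)"
    by (simp add: s_def)
  have prod: "z1 * z2 = of_real d"
    using s2 by (simp add: z1_def z2_def field_simps power2_eq_square)
  have sum: "z1 + z2 = of_real p"
    by (simp add: z1_def z2_def field_simps)
  have fact: "z\<^sup>2 - of_real p * z + of_real d = (z - z1) * (z - z2)" for z
    unfolding prod[symmetric] sum[symmetric] by (simp add: algebra_simps power2_eq_square)
  have z1: "cmod z1 < 1" and z2: "cmod z2 < 1"
    using roots fact by auto
  have "\<bar>d\<bar> = cmod z1 * cmod z2"
    by (metis norm_mult norm_of_real prod)
  also have "\<dots> < 1"
    using z1 z2 mult_strict_mono'[of "cmod z1" 1 "cmod z2" 1] by simp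
  finally have d: "\<bar>d\<bar> < 1" .
  \<comment> \<open>This is the value of the polynomial at \<open>e\<close>. Real roots in (-1, 1)
    make both linear factors positive there.\<close>
  have pos: "1 - e * p + d > 0" if e: "e = 1 \<or> e = -1" for e :: real
  proof (cases "p\<^sup>2 - 4 * d \<ge> 0")
    case True
    define r where "r = sqrt (p\<^sup>2 - 4 * d)"
    have "s = of_real r"
      using True by (simp add: s_def r_def csqrt_of_real_nonneg)
    then have "z1 = of_real ((p + r) / 2)" "z2 = of_real ((p - r) / 2)"
      by (simp_all add: z1_def z2_def)
    then have b: "\<bar>(p + r) / 2\<bar> < 1" "\<bar>(p - r) / 2\<bar> < 1"
      using z1 z2 by (metis norm_of_real)+
    have "r\<^sup>2 = p\<^sup>2 - 4 * d"
      using True by (simp add: r_def)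
    then have "1 - e * p + d = (1 - e * ((p + r) / 2)) * (1 - e * ((p - r) / 2))"
      using e by (auto simp: field_simps power2_eq_square)
    moreover have "\<dots> > 0"
      using b e by (intro mult_pos_pos) auto
    ultimately show ?thesis by simp
  next
    case False
    \<comment> \<open>A negative discriminant means \<open>d > p\<^sup>2 / 4\<close>, so
      \<open>1 - e * p + d\<close> exceeds this square.\<close>
    have "0 \<le> (1 - e * p / 2)\<^sup>2"
      by simp
    then show ?thesis
      using False e by (auto simp: field_simps power2_eq_square)
  qed
  show "\<bar>d\<bar> < 1 \<and> \<bar>p\<bar> < 1 + d"
    using d pos[of 1] pos[of "-1"] by auto
next
  assume pd: "\<bar>d\<bar> < 1 \<and> \<bar>p\<bar> < 1 + d"
  show "\<forall>z::complex. z\<^sup>2 - of_real p * z + of_real d = 0 \<longrightarrow> cmod z < 1"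
  proof (intro allI impI)
    fix z :: complex
    assume z: "z\<^sup>2 - of_real p * z + of_real d = 0"
    define x y where "x = Re z" and "y = Im z"
    have re: "x\<^sup>2 - y\<^sup>2 - p * x + d = 0" and im: "y * (2 * x - p) = 0"
      using arg_cong[OF z, of Re] arg_cong[OF z, of Im]
      by (simp_all add: x_def y_def power2_eq_square algebra_simps)
    show "cmod z < 1"
    proof (cases "y = 0")
      case True
      \<comment> \<open>The other root. Positivity at 1 and -1 puts both roots on the same side of
        each of these points, so a root outside (-1, 1) would drag the other one out and force
        \<open>\<bar>d\<bar> \<ge> 1\<close>.\<close>
      define x' where "x' = p - x"
      have d: "d = x * x'"
        using re True by (simp add: x'_def algebra_simps power2_eq_square)
      have p: "p = x + x'"
        by (simp add: x'_def)
      have pos: "(1 - x) * (1 - x') > 0" "(1 + x) * (1 + x') > 0"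
        using pd by (auto simp: p d algebra_simps)
      have "\<bar>x\<bar> < 1"
      proof (rule ccontr)
        assume "\<not> \<bar>x\<bar> < 1"
        then have "1 \<le> \<bar>x\<bar>" "1 \<le> \<bar>x'\<bar>"
          using pos by (auto simp: zero_less_mult_iff abs_if split: if_splits)
        then have "1 \<le> \<bar>d\<bar>"
          using mult_mono[of 1 "\<bar>x\<bar>" 1 "\<bar>x'\<bar>"] by (simp add: d abs_mult)
        then show False
          using pd by simp
      qed
      then show ?thesis
        using True by (simp add: cmod_def x_def y_def)
    next
      case False
      \<comment> \<open>A non-real root is paired with its conjugate, so \<open>d\<close> is its
        squared modulus.\<close>
      then have "p = 2 * x"
        using im by simp
      then have "x\<^sup>2 + y\<^sup>2 = d"
        using re by (simp add: algebra_simps power2_eq_square)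
      then show ?thesis
        using pd by (simp add: cmod_def x_def y_def abs_less_iff)
    qed
  qed
qed

text \<open>The spectral radius is a \<open>Max\<close>; the spectrum is finite and, in positive
  dimension, nonempty, so bounding the \<open>Max\<close> is bounding every element.\<close>

lemma spectral_radius_less_iff:
  fixes A :: "complex mat"
  assumes "A \<in> carrier_mat n n" and "0 < n"
  shows "spectral_radius A < r \<longleftrightarrow> (\<forall>z. eigenvalue A z \<longrightarrow> cmod z < r)"
  using card_finite_spectrum(1)[OF assms(1)] spectrum_non_empty[OF assms]
  by (auto simp: spectral_radius_def spectrum_def)

lemma det_2x2:
  assumes "A \<in> carrier_mat 2 2"
  shows "Determinant.det A = A $$ (0, 0) * A $$ (1, 1) - A $$ (0, 1) * A $$ (1, 0)"
  using assms
  by (subst laplace_expansion_row[OF assms, of 0])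
    (auto simp: cofactor_def mat_delete_def numeral_2_eq_2 det_single algebra_simps)

lemma eigenvalue_2x2_iff:
  fixes a b c d z :: "'a :: field"
  shows "eigenvalue (mat_of_rows_list 2 [[a, b], [c, d]]) z \<longleftrightarrow>
         z\<^sup>2 - (a + d) * z + (a * d - b * c) = 0"
proof -
  let ?A = "mat_of_rows_list 2 [[a, b], [c, d]]"
  have A: "?A \<in> carrier_mat 2 2"
    by (auto simp: mat_of_rows_list_def)
  have "- char_matrix ?A z \<in> carrier_mat 2 2"
    using A by simp
  note det = det_2x2[OF this]
  have "poly (char_poly ?A) z = z\<^sup>2 - (a + d) * z + (a * d - b * c)"
    unfolding char_poly_matrix[OF A] det
    by (simp add: char_matrix_def mat_of_rows_list_def algebra_simps power2_eq_square)
  then show ?thesis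
    by (simp add: eigenvalue_root_char_poly[OF A])
qed

lemma spectral_radius_real_2x2_less_1_iff:
  fixes a b c d :: real
  shows "spectral_radius (map_mat complex_of_real (mat_of_rows_list 2 [[a, b], [c, d]])) < 1 \<longleftrightarrow>
         \<bar>a * d - b * c\<bar> < 1 \<and> \<bar>a + d\<bar> < 1 + (a * d - b * c)"
proof -
  have map: "map_mat complex_of_real (mat_of_rows_list 2 [[a, b], [c, d]]) =
      mat_of_rows_list 2 [[of_real a, of_real b], [of_real c, of_real d]]"
    by (rule eq_matI) (auto simp: mat_of_rows_list_def numeral_2_eq_2 less_Suc_eq)
  show ?thesis
    unfolding quadratic_roots_in_unit_disc_iff[symmetric] map
    by (subst spectral_radius_less_iff[where n = 2])
      (simp_all add: eigenvalue_2x2_iff, simp add: mat_of_rows_list_def numeral_2_eq_2)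
qed

section \<open>The fixed point expressed through \<open>q\<close>\<close>

context
  fixes k :: nat and \<eta> \<beta>\<^sub>1 \<beta>\<^sub>2 q :: real
  assumes k: "k \<ge> 3" and \<eta>: "\<eta> > 0"
    and \<beta>\<^sub>1: "0 \<le> \<beta>\<^sub>1" "\<beta>\<^sub>1 < 1"
    and \<beta>\<^sub>2: "0 < \<beta>\<^sub>2" "\<beta>\<^sub>2 < 1"
    and q: "q = \<beta>\<^sub>2 powr (1 / (2 * (real k - 2)))"
begin

lemma q_bounds: "0 < q" "q < 1"
proof -
  show "0 < q"
    using \<beta>\<^sub>2 by (simp add: q)
  have "0 < 1 / (2 * (real k - 2))"
    using k by simp
  then show "q < 1"
    unfolding q using \<beta>\<^sub>2 powr_less_mono2[of "1 / (2 * (real k - 2))" \<beta>\<^sub>2 1] by simp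
qed

text \<open>All exponents of \<open>\<beta>\<^sub>2\<close> in the system have denominator
  \<open>2 * (k - 2)\<close>, so this turns each of them into a power of \<open>q\<close>.\<close>

lemma powr_q: "\<beta>\<^sub>2 powr (a / (2 * (real k - 2))) = q powr a"
  by (simp add: q powr_powr)

lemma powr_minus_q: "\<beta>\<^sub>2 powr (- (a / (2 * (real k - 2)))) = q powr (- a)"
  using powr_q[of "- a"] by simp

lemma q_powr_diff: "q powr (real k - real n) = q ^ k / q ^ n"
  using q_bounds by (simp add: powr_diff powr_realpow)

text \<open>This keeps the second coordinate stationary: at \<open>x = 0\<close> the root in
  \<open>adam_step\<close> is \<open>sqrt \<beta>\<^sub>2\<close>, which cancels the factor
  \<open>q ^ (k - 2)\<close>.\<close>

lemma sqrt_\<beta>\<^sub>2: "sqrt \<beta>\<^sub>2 = q ^ (k - 2)"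
proof -
  have "(real k - 2) / (2 * (real k - 2)) = 1 / 2"
    using k by simp
  then have "sqrt \<beta>\<^sub>2 = \<beta>\<^sub>2 powr ((real k - 2) / (2 * (real k - 2)))"
    using \<beta>\<^sub>2 by (simp only: powr_half_sqrt)
  also have "\<dots> = q ^ (k - 2)"
    unfolding powr_q using q_bounds k by (simp add: powr_realpow[symmetric] of_nat_diff)
  finally show ?thesis .
qed

lemma omega_denom_q: "omega_denom k \<beta>\<^sub>1 \<beta>\<^sub>2 = 1 - \<beta>\<^sub>1 / q ^ (k - 1)"
proof -
  have "q powr (- (real k - 1)) = inverse (q powr real (k - 1))"
    using k by (simp add: powr_minus[symmetric] of_nat_diff)
  then show ?thesis
    unfolding omega_denom_def powr_minus_q using q_bounds
    by (simp add: powr_realpow divide_inverse)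
qed

text \<open>Since \<open>1 - q\<close>, \<open>\<eta>\<close> and \<open>1 - \<beta>\<^sub>1\<close>
  are positive, \<open>lambda_star\<close> has the sign of the denominator of
  \<open>omega_star\<close>.\<close>

lemma nontrivial_fixed_point_exists_iff_denom_pos:
  "nontrivial_fixed_point_exists k \<eta> \<beta>\<^sub>1 \<beta>\<^sub>2 \<longleftrightarrow> omega_denom k \<beta>\<^sub>1 \<beta>\<^sub>2 > 0"
  unfolding nontrivial_fixed_point_exists_def lambda_star_def omega_star_def q[symmetric]
  using q_bounds \<eta> \<beta>\<^sub>1
  by (auto simp: zero_le_divide_iff zero_le_mult_iff zero_less_mult_iff mult_le_0_iff)

lemma nontrivial_fixed_point_exists_iff:
  "nontrivial_fixed_point_exists k \<eta> \<beta>\<^sub>1 \<beta>\<^sub>2 \<longleftrightarrow>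
   \<beta>\<^sub>1 < \<beta>\<^sub>2 powr ((real k - 1) / (2 * (real k - 2)))"
proof -
  have "q powr (real k - 1) = q ^ (k - 1)"
    using k q_bounds by (simp add: powr_realpow[symmetric] of_nat_diff)
  then show ?thesis
    unfolding nontrivial_fixed_point_exists_iff_denom_pos omega_denom_q powr_q
    using q_bounds by simp
qed

text \<open>The nonzero product \<open>\<eta> * \<omega>\<close> is exactly the denominator of
  \<open>lambda_star\<close> and cancels. Both stationarity and the convergence rate rest on this
  value.\<close>

lemma contraction_factor_fixed_point:
  assumes "nontrivial_fixed_point_exists k \<eta> \<beta>\<^sub>1 \<beta>\<^sub>2"
  shows "1 - \<eta> * omega_star k \<beta>\<^sub>1 \<beta>\<^sub>2 * lambda_star k \<eta> \<beta>\<^sub>1 \<beta>\<^sub>2 = q"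
  using assms unfolding nontrivial_fixed_point_exists_def lambda_star_def q[symmetric] by simp

lemma adam_step_fixed_point:
  assumes "nontrivial_fixed_point_exists k \<eta> \<beta>\<^sub>1 \<beta>\<^sub>2"
  shows "adam_step k \<eta> \<beta>\<^sub>1 \<beta>\<^sub>2 (nontrivial_fixed_point k \<eta> \<beta>\<^sub>1 \<beta>\<^sub>2) =
         nontrivial_fixed_point k \<eta> \<beta>\<^sub>1 \<beta>\<^sub>2"
proof -
  let ?\<omega> = "omega_star k \<beta>\<^sub>1 \<beta>\<^sub>2" and ?D = "omega_denom k \<beta>\<^sub>1 \<beta>\<^sub>2"
  have D: "?D \<noteq> 0"
    using assms by (simp add: nontrivial_fixed_point_exists_def)
  have "?\<omega> * ?D = 1 - \<beta>\<^sub>1"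
    using D by (simp add: omega_star_def)
  then have "\<beta>\<^sub>1 * ?\<omega> / q ^ (k - 1) + 1 - \<beta>\<^sub>1 = ?\<omega>"
    by (simp add: omega_denom_q algebra_simps)
  then show ?thesis
    using q_bounds
    by (simp add: nontrivial_fixed_point_def adam_step_def
        contraction_factor_fixed_point[OF assms] sqrt_\<beta>\<^sub>2)
qed

section \<open>Stability of the matrix \<open>J\<close>\<close>

lemma adam_J_q:
  assumes "b = \<beta>\<^sub>1 / q ^ k" and "D = omega_denom k \<beta>\<^sub>1 \<beta>\<^sub>2" and "K = real k"
  shows "adam_J k \<eta> \<beta>\<^sub>1 \<beta>\<^sub>2 = mat_of_rows_list 2
    [[b * (K - 1 - (K - 2) * q), b * (\<eta> * (1 - \<beta>\<^sub>1)\<^sup>2 * (K - 1)) / D\<^sup>2],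
     [- ((K - 2) * (1 - q)\<^sup>2 * D\<^sup>2 / (q * (\<eta> * (1 - \<beta>\<^sub>1)\<^sup>2))), 1 - (K - 2) * (1 - q) / q]]"
proof -
  have s: "sqrt \<beta>\<^sub>2 = q ^ k / q ^ 2"
    using sqrt_\<beta>\<^sub>2 q_bounds k by (simp add: power_diff)
  have e: "\<beta>\<^sub>2 powr (- real k / (2 * (real k - 2))) = 1 / q ^ k"
          "\<beta>\<^sub>2 powr ((1 - real k) / (2 * (real k - 2))) = q / q ^ k"
          "\<beta>\<^sub>2 powr ((real k - 3) / (2 * (real k - 2))) = q ^ k / q ^ 3"
    unfolding powr_q using q_bounds q_powr_diff[of 3]
    by (simp_all add: powr_minus powr_diff powr_realpow divide_inverse)
  \<comment> \<open>The matrices are compared entry by entry. The value \<open>D = 0\<close> is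
    covered too, which the stability proof relies on.\<close>
  show ?thesis
    unfolding adam_J_def Let_def e s omega_denom_def[symmetric] q[symmetric] assms
    by (intro arg_cong[where f = "mat_of_rows_list 2"] list.inject[THEN iffD2] conjI refl;
        use q_bounds \<eta> \<beta>\<^sub>1 in \<open>simp add: divide_simps\<close>;
        simp add: algebra_simps eval_nat_numeral)
qed

lemma adam_J_stable_iff:
  "spectral_radius (map_mat complex_of_real (adam_J k \<eta> \<beta>\<^sub>1 \<beta>\<^sub>2)) < 1 \<longleftrightarrow>
     \<beta>\<^sub>1 < q ^ k \<and>
     \<beta>\<^sub>1 > ((real k - 2) / q - real k) / ((real k - (real k - 2) * q) / q ^ k)"
proof -
  define b where "b = \<beta>\<^sub>1 / q ^ k"
  define D where "D = omega_denom k \<beta>\<^sub>1 \<beta>\<^sub>2"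
  define K where "K = real k"
  \<comment> \<open>\<open>T\<close> is the trace of \<open>J\<close>. The equations
    \<open>plus\<close> and \<open>minus\<close> below give the characteristic polynomial at -1 and
    1 when \<open>b\<close> is the determinant.\<close>
  define T where "T = b * (K - 1 - (K - 2) * q) + (1 - (K - 2) * (1 - q) / q)"
  have K: "K \<ge> 3"
    using k by (simp add: K_def)
  have b0: "b \<ge> 0"
    using \<beta>\<^sub>1 q_bounds by (simp add: b_def)
  have "(K - 2) * q \<le> K - 2"
    using K q_bounds by (simp add: mult_left_le)
  then have c: "0 < K - (K - 2) * q"
    by linarith
  have plus: "1 + T + b = b * (K - (K - 2) * q) - ((K - 2) / q - K)"
    using q_bounds by (simp add: T_def field_simps)
  have minus: "1 - T + b = (K - 2) * (1 - q) * (1 / q - b)"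
    using q_bounds by (simp add: T_def field_simps)
  have bound1: "\<beta>\<^sub>1 < q ^ k \<longleftrightarrow> b < 1"
    using q_bounds by (simp add: b_def)
  have bound2: "\<beta>\<^sub>1 > ((K - 2) / q - K) / ((K - (K - 2) * q) / q ^ k) \<longleftrightarrow> 0 < 1 + T + b"
  proof -
    have "((K - 2) / q - K) / ((K - (K - 2) * q) / q ^ k) < \<beta>\<^sub>1 \<longleftrightarrow>
          ((K - 2) / q - K) < \<beta>\<^sub>1 * ((K - (K - 2) * q) / q ^ k)"
      using c q_bounds by (intro pos_divide_less_eq) simp
    also have "\<beta>\<^sub>1 * ((K - (K - 2) * q) / q ^ k) = b * (K - (K - 2) * q)"
      by (simp add: b_def)
    finally show ?thesis
      by (simp add: plus)
  qed
  show ?thesis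
  proof (cases "D = 0")
    case True
    \<comment> \<open>Here \<open>D = 0\<close>, so division by zero makes \<open>J\<close> diagonal, with an entry above 1.\<close>
    have "q ^ k = q * q ^ (k - 1)"
      using k by (simp add: power_eq_if)
    then have b: "b = 1 / q"
      using True q_bounds by (auto simp: D_def omega_denom_q b_def field_simps)
    \<comment> \<open>The upper stability bound fails, so it remains to show that the spectral
      condition fails as well.\<close>
    have "\<not> b < 1"
      using q_bounds by (simp add: b)
    define a d where "a = b * (K - 1 - (K - 2) * q)" and "d = 1 - (K - 2) * (1 - q) / q"
    have "a - 1 = (K - 1) * (1 - q) / q"
      using q_bounds by (simp add: a_def b field_simps)
    then have "1 < a"
      using K q_bounds by (smt (verit) divide_pos_pos mult_pos_pos)
    moreover have "d < 1"
      using K q_bounds by (simp add: d_def)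
    \<comment> \<open>For diagonal \<open>J\<close> this product is the characteristic polynomial at
      1.\<close>
    ultimately have "(1 - a) * (1 - d) < 0"
      by (simp add: mult_neg_pos)
    then have "\<not> \<bar>a + d\<bar> < 1 + a * d"
      by (auto simp: algebra_simps)
    with \<open>\<not> b < 1\<close> show ?thesis
      unfolding adam_J_q[OF b_def D_def K_def] spectral_radius_real_2x2_less_1_iff bound1
        a_def[symmetric] d_def[symmetric]
      using True by simp
  next
    case False
    have det: "b * (K - 1 - (K - 2) * q) * (1 - (K - 2) * (1 - q) / q) -
        b * (\<eta> * (1 - \<beta>\<^sub>1)\<^sup>2 * (K - 1)) / D\<^sup>2 *
          - ((K - 2) * (1 - q)\<^sup>2 * D\<^sup>2 / (q * (\<eta> * (1 - \<beta>\<^sub>1)\<^sup>2))) = b"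
    proof -
      \<comment> \<open>In the product of the off-diagonal entries both \<open>D\<^sup>2\<close> and
        \<open>E\<close> cancel; naming \<open>E\<close> lets the simplifier treat it as one nonzero
        factor.\<close>
      define E where "E = \<eta> * (1 - \<beta>\<^sub>1)\<^sup>2"
      have "E \<noteq> 0"
        using \<eta> \<beta>\<^sub>1 by (simp add: E_def)
      then show ?thesis
        unfolding E_def[symmetric] using False q_bounds
        by (simp add: field_simps power2_eq_square)
    qed
    \<comment> \<open>As \<open>b \<ge> 0\<close>, the lower bound on the determinant is automatic,
      and \<open>b < 1 < 1 / q\<close> gives positivity at 1. Only \<open>b < 1\<close> and
      positivity at -1 remain.\<close>
    have "\<bar>b\<bar> < 1 \<and> \<bar>T\<bar> < 1 + b \<longleftrightarrow> b < 1 \<and> 0 < 1 + T + b"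
    proof -
      have "0 < 1 - T + b" if "b < 1"
      proof -
        have "1 < 1 / q"
          using q_bounds by simp
        then show ?thesis
          unfolding minus using that K q_bounds by (intro mult_pos_pos) linarith+
      qed
      then show ?thesis
        using b0 by auto
    qed
    then show ?thesis
      unfolding adam_J_q[OF b_def D_def K_def] spectral_radius_real_2x2_less_1_iff det
        K_def[symmetric] bound1 bound2 by (simp add: T_def)
  qed
qed

section \<open>The convergence rate\<close>

lemma trajectory_ratio_tendsto:
  assumes ex: "nontrivial_fixed_point_exists k \<eta> \<beta>\<^sub>1 \<beta>\<^sub>2"
    and traj: "adam_trajectory k \<eta> \<beta>\<^sub>1 \<beta>\<^sub>2 \<omega> l x" and "x 0 \<noteq> 0"
    and lim: "(\<lambda>t. (\<omega> t, l t, x t)) \<longlonglongrightarrow> nontrivial_fixed_point k \<eta> \<beta>\<^sub>1 \<beta>\<^sub>2"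
  shows "(\<lambda>t. x (Suc t) / x t) \<longlonglongrightarrow> q"
proof -
  have step: "x (Suc t) = (1 - \<eta> * \<omega> t * l t) * x t" "1 - \<eta> * \<omega> t * l t \<noteq> 0" for t
    using traj unfolding adam_trajectory_def adam_step_def by auto
  \<comment> \<open>Well-definedness of the trajectory keeps each factor nonzero, so the ratio of
    consecutive \<open>x\<close> is exactly that factor, a continuous function of
    \<open>\<omega>\<close> and \<open>l\<close>.\<close>
  have "x t \<noteq> 0" for t
    using step by (induction t) (simp_all add: \<open>x 0 \<noteq> 0\<close>)
  then have "(\<lambda>t. x (Suc t) / x t) = (\<lambda>t. 1 - \<eta> * \<omega> t * l t)"
    by (simp add: step)
  moreover have "\<omega> \<longlonglongrightarrow> omega_star k \<beta>\<^sub>1 \<beta>\<^sub>2" "l \<longlonglongrightarrow> lambda_star k \<eta> \<beta>\<^sub>1 \<beta>\<^sub>2"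
    using tendsto_fst[OF lim] tendsto_fst[OF tendsto_snd[OF lim]]
    by (simp_all add: nontrivial_fixed_point_def)
  then have "(\<lambda>t. 1 - \<eta> * \<omega> t * l t) \<longlonglongrightarrow>
      1 - \<eta> * omega_star k \<beta>\<^sub>1 \<beta>\<^sub>2 * lambda_star k \<eta> \<beta>\<^sub>1 \<beta>\<^sub>2"
    by (intro tendsto_intros)
  ultimately show ?thesis
    by (simp add: contraction_factor_fixed_point[OF ex])
qed

end

theorem theorem4p1:
  fixes k :: nat and \<eta> \<beta>\<^sub>1 \<beta>\<^sub>2 :: real
  assumes "k \<ge> 4" and "even k"
    and "\<eta> > 0"
    and "0 \<le> \<beta>\<^sub>1" and "\<beta>\<^sub>1 < 1"
    and "0 < \<beta>\<^sub>2" and "\<beta>\<^sub>2 < 1"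
  shows
    "(nontrivial_fixed_point_exists k \<eta> \<beta>\<^sub>1 \<beta>\<^sub>2 \<longleftrightarrow>
        \<beta>\<^sub>1 < \<beta>\<^sub>2 powr ((real k - 1) / (2 * (real k - 2))))
     \<and>
     (nontrivial_fixed_point_exists k \<eta> \<beta>\<^sub>1 \<beta>\<^sub>2 \<longrightarrow>
        adam_step k \<eta> \<beta>\<^sub>1 \<beta>\<^sub>2 (nontrivial_fixed_point k \<eta> \<beta>\<^sub>1 \<beta>\<^sub>2) =
          nontrivial_fixed_point k \<eta> \<beta>\<^sub>1 \<beta>\<^sub>2)
     \<and>
     (spectral_radius (map_mat complex_of_real (adam_J k \<eta> \<beta>\<^sub>1 \<beta>\<^sub>2)) < 1 \<longleftrightarrow>
        \<beta>\<^sub>1 < \<beta>\<^sub>2 powr (real k / (2 * (real k - 2))) \<and>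
        \<beta>\<^sub>1 > ((real k - 2) * \<beta>\<^sub>2 powr (- (1 / (2 * (real k - 2)))) - real k)
              / ((real k - (real k - 2) * \<beta>\<^sub>2 powr (1 / (2 * (real k - 2))))
                   * \<beta>\<^sub>2 powr (- (real k / (2 * (real k - 2))))))
     \<and>
     (nontrivial_fixed_point_exists k \<eta> \<beta>\<^sub>1 \<beta>\<^sub>2 \<longrightarrow>
        (\<forall>\<omega> l x :: nat \<Rightarrow> real.
           adam_trajectory k \<eta> \<beta>\<^sub>1 \<beta>\<^sub>2 \<omega> l x \<longrightarrow>
           x 0 \<noteq> 0 \<longrightarrow>
           (\<lambda>t. (\<omega> t, l t, x t)) \<longlonglongrightarrow> nontrivial_fixed_point k \<eta> \<beta>\<^sub>1 \<beta>\<^sub>2 \<longrightarrow>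
           (\<lambda>t. x (Suc t) / x t) \<longlonglongrightarrow> \<beta>\<^sub>2 powr (1 / (2 * (real k - 2)))))"
proof -
  define q where "q = \<beta>\<^sub>2 powr (1 / (2 * (real k - 2)))"
  have k: "3 \<le> k"
    using \<open>k \<ge> 4\<close> by simp
  note ctx = k assms(3-7) q_def
  \<comment> \<open>These rewrite the stability bounds into the form of
    \<open>adam_J_stable_iff\<close>; the existence bound keeps its \<open>powr\<close>
    form.\<close>
  have e: "\<beta>\<^sub>2 powr (real k / (2 * (real k - 2))) = q ^ k"
          "\<beta>\<^sub>2 powr (- (1 / (2 * (real k - 2)))) = 1 / q"
          "\<beta>\<^sub>2 powr (- (real k / (2 * (real k - 2)))) = 1 / q ^ k"
    using q_bounds[OF ctx] powr_q[OF ctx, of "real k"] powr_minus_q[OF ctx, of "real k"]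
      powr_minus_q[OF ctx, of 1]
    by (simp_all add: powr_minus powr_realpow divide_inverse)
  show ?thesis
    unfolding e q_def[symmetric]
    using nontrivial_fixed_point_exists_iff[OF ctx] adam_step_fixed_point[OF ctx]
      adam_J_stable_iff[OF ctx] trajectory_ratio_tendsto[OF ctx]
    by simp
qed

end
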